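(* Let $p,q,r$ be three distinct primes with $r\mid q-1$. Let $x$ be a generator of the cyclic group $\mathbb{Z}_{r^2}$, let $\psi\in\mathsf{Aut}(\mathbb{Z}_q)$ be an automorphism of order $r$, and let $\varphi:\mathbb{Z}_{r^2}\to\mathsf{Aut}(\mathbb{Z}_q)$ be the homomorphism with $\varphi(x)=\psi$. Then the group $\mathbb{Z}_p\times(\mathbb{Z}_q\rtimes_\varphi\mathbb{Z}_{r^2})$ is a minimal imperfect group.
   Context: For a group $G$, the power graph $\mathsf{Pow}(G)$ has vertex set $G$, with distinct $a,b$ adjacent iff $a\in\langle b\rangle$ or $b\in\langle a\rangle$. The enhanced power graph $\mathsf{EPow}(G)$ has vertex set $G$, with distinct $a,b$ adjacent iff $\langle a,b\rangle$ is cyclic. The difference graph $D(G)$ is the graph $\mathsf{EPow}(G)-\mathsf{Pow}(G)$ with all isolated vertices removed; thus $x\sim y$ in $D(G)$ iff $\langle x,y\rangle$ is cyclic, $x\notin\langle y\rangle$ and $y\notin\langle x\rangle$. A group $G$ is called a minimal imperfect group if $D(G)$ is not perfect and $D(H)$ is perfect for every proper subgroup $H$ of $G$. The semidirect product $N\rtimes_\varphi K$ has multiplication $(a_1,a_2)(b_1,b_2)=(a_1\varphi(a_2)(b_1),a_2b_2)$. *)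

theory Defs
  imports
    "HOL-Library.Ramsey"
    "HOL-Library.Extended_Nat"
    "HOL-Computational_Algebra.Primes"
    "HOL-Algebra.Bij"
    "HOL-Algebra.Elementary_Groups"
    "HOL-Algebra.Multiplicative_Group"
begin

section \<open>Simple graphs and perfection\<close>

text \<open>A simple graph is a pair \<open>(V, E)\<close> of a vertex set and a set of two-element
  subsets of \<open>V\<close>.\<close>

type_synonym 'a sgraph = "'a set \<times> 'a set set"

definition verts :: "'a sgraph \<Rightarrow> 'a set" where
  "verts \<Gamma> = fst \<Gamma>"

definition edges :: "'a sgraph \<Rightarrow> 'a set set" where
  "edges \<Gamma> = snd \<Gamma>"

definition induced_subgraph :: "'a sgraph \<Rightarrow> 'a set \<Rightarrow> 'a sgraph" where
  "induced_subgraph \<Gamma> W = (W, {e \<in> edges \<Gamma>. e \<subseteq> W})"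

definition graph_minus :: "'a sgraph \<Rightarrow> 'a sgraph \<Rightarrow> 'a sgraph" where
  "graph_minus \<Gamma> \<Delta> = (verts \<Gamma>, edges \<Gamma> - edges \<Delta>)"

definition remove_isolated :: "'a sgraph \<Rightarrow> 'a sgraph" where
  "remove_isolated \<Gamma> = ({v \<in> verts \<Gamma>. \<exists>e \<in> edges \<Gamma>. v \<in> e}, edges \<Gamma>)"

definition proper_colouring :: "'a sgraph \<Rightarrow> nat \<Rightarrow> ('a \<Rightarrow> nat) \<Rightarrow> bool" where
  "proper_colouring \<Gamma> k c \<longleftrightarrow>
     c ` verts \<Gamma> \<subseteq> {..<k} \<and>
     (\<forall>u \<in> verts \<Gamma>. \<forall>v \<in> verts \<Gamma>. {u, v} \<in> edges \<Gamma> \<longrightarrow> c u \<noteq> c v)"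

text \<open>Both invariants take values in \<^typ>\<open>enat\<close>, so that they are meaningful for
  infinite graphs too: a graph without a finite colouring, or with finite cliques of
  unbounded size, gets the value \<open>\<infinity>\<close>.\<close>

definition chromatic_number :: "'a sgraph \<Rightarrow> enat" where
  "chromatic_number \<Gamma> = Inf {enat k | k. \<exists>c. proper_colouring \<Gamma> k c}"

definition clique_number :: "'a sgraph \<Rightarrow> enat" where
  "clique_number \<Gamma> =
     Sup {enat (card K) | K. finite K \<and> K \<subseteq> verts \<Gamma> \<and> clique K (edges \<Gamma>)}"

definition perfect_graph :: "'a sgraph \<Rightarrow> bool" where
  "perfect_graph \<Gamma> \<longleftrightarrow>
     (\<forall>W \<subseteq> verts \<Gamma>.
        chromatic_number (induced_subgraph \<Gamma> W) = clique_number (induced_subgraph \<Gamma> W))"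


section \<open>Graphs of a group\<close>

definition power_graph :: "('a, 'b) monoid_scheme \<Rightarrow> 'a sgraph" where
  "power_graph G =
     (carrier G,
      {{a, b} | a b. a \<in> carrier G \<and> b \<in> carrier G \<and> a \<noteq> b \<and>
         (a \<in> generate G {b} \<or> b \<in> generate G {a})})"

definition enhanced_power_graph :: "('a, 'b) monoid_scheme \<Rightarrow> 'a sgraph" where
  "enhanced_power_graph G =
     (carrier G,
      {{a, b} | a b. a \<in> carrier G \<and> b \<in> carrier G \<and> a \<noteq> b \<and>
         cyclic_group (subgroup_generated G {a, b})})"

definition difference_graph :: "('a, 'b) monoid_scheme \<Rightarrow> 'a sgraph" where
  "difference_graph G =
     remove_isolated (graph_minus (enhanced_power_graph G) (power_graph G))"

definition minimal_imperfect_group :: "('a, 'b) monoid_scheme \<Rightarrow> bool" where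
  "minimal_imperfect_group G \<longleftrightarrow>
     group G \<and>
     \<not> perfect_graph (difference_graph G) \<and>
     (\<forall>H. subgroup H G \<and> H \<noteq> carrier G \<longrightarrow>
          perfect_graph (difference_graph (G\<lparr>carrier := H\<rparr>)))"


section \<open>Semidirect products\<close>

definition semidirect_product ::
    "('a, 'c) monoid_scheme \<Rightarrow> ('b, 'd) monoid_scheme \<Rightarrow> ('b \<Rightarrow> 'a \<Rightarrow> 'a) \<Rightarrow> ('a \<times> 'b) monoid"
  where
  "semidirect_product N K \<phi> =
     \<lparr>carrier = carrier N \<times> carrier K,
      mult = (\<lambda>(a\<^sub>1, a\<^sub>2) (b\<^sub>1, b\<^sub>2). (a\<^sub>1 \<otimes>\<^bsub>N\<^esub> \<phi> a\<^sub>2 b\<^sub>1, a\<^sub>2 \<otimes>\<^bsub>K\<^esub> b\<^sub>2)),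
      one = (\<one>\<^bsub>N\<^esub>, \<one>\<^bsub>K\<^esub>)\<rparr>"

end

theory Submission
  imports Defs "HOL-Number_Theory.Cong"
begin

text \<open>In a finite group, two elements are adjacent in the difference graph iff they lie in a common
  cyclic subgroup and their orders are incomparable under divisibility. A proper subgroup of the
  group \<open>G\<close> of order \<open>p q r\<^sup>2\<close> has order dividing \<open>q r\<^sup>2\<close>, \<open>p r\<^sup>2\<close> or \<open>p q r\<close>. In the first two cases
  the graph is bipartite, since of two incomparable divisors of \<open>t s\<^sup>2\<close> exactly one is divisible by
  \<open>t\<close>. In the last case the subgroup lies in the cyclic group of order \<open>p q r\<close> generated by
  \<open>(1, 1, r)\<close>, and the graph is a triangular prism whose vertices are blown up to independent sets,
  hence perfect. In \<open>G\<close> itself, elements \<open>(0, 0, 1)\<close>, \<open>(1, 0, r)\<close>, \<open>(1, 1, 0)\<close>, \<open>(0, 0, r)\<close>, \<open>(1, 0, 0)\<close>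
  of orders \<open>r\<^sup>2\<close>, \<open>p r\<close>, \<open>p q\<close>, \<open>r\<close>, \<open>p\<close> induce a 5-cycle.\<close>

section \<open>Perfection of graphs\<close>

lemma verts_induced_subgraph [simp]: "verts (induced_subgraph \<Gamma> W) = W"
  by (simp add: verts_def induced_subgraph_def)

lemma edges_induced_subgraph [simp]:
  "edges (induced_subgraph \<Gamma> W) = {e \<in> edges \<Gamma>. e \<subseteq> W}"
  by (simp add: edges_def induced_subgraph_def)

lemma clique_card_le_colouring:
  assumes c: "proper_colouring \<Gamma> k c" and K: "K \<subseteq> verts \<Gamma>" "clique K (edges \<Gamma>)"
  shows "card K \<le> k"
proof -
  have "inj_on c K"
  proof (rule inj_onI)
    fix u v assume uv: "u \<in> K" "v \<in> K" "c u = c v"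
    show "u = v"
    proof (rule ccontr)
      assume "u \<noteq> v"
      with uv K have "{u, v} \<in> edges \<Gamma>" by (auto simp: clique_def)
      with uv K c show False by (auto simp: proper_colouring_def)
    qed
  qed
  moreover have "c ` K \<subseteq> {..<k}"
    using c K by (auto simp: proper_colouring_def)
  ultimately show ?thesis
    using card_inj_on_le[of c K "{..<k}"] by simp
qed

text \<open>The colouring bounds the chromatic number from above, the clique bounds the clique
  number from below, and a clique never has more vertices than a proper colouring has colours. All
  perfection proofs below end in this criterion.\<close>

lemma chromatic_number_eq_clique_numberI:
  assumes c: "proper_colouring \<Gamma> k c"
    and K: "K \<subseteq> verts \<Gamma>" "clique K (edges \<Gamma>)" "finite K" "card K = k"
  shows "chromatic_number \<Gamma> = clique_number \<Gamma>"
proof (rule antisym)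
  have "chromatic_number \<Gamma> \<le> enat k"
    unfolding chromatic_number_def using c by (intro Inf_lower) auto
  also have "\<dots> \<le> clique_number \<Gamma>"
    unfolding clique_number_def using K by (intro Sup_upper) auto
  finally show "chromatic_number \<Gamma> \<le> clique_number \<Gamma>" .
  show "clique_number \<Gamma> \<le> chromatic_number \<Gamma>"
    unfolding clique_number_def chromatic_number_def
    by (intro Sup_least Inf_greatest) (auto intro: clique_card_le_colouring)
qed

text \<open>The predicate serves as a 2-colouring. The clique of matching size is an edge, a single
  vertex or the empty set, whence the case distinctions.\<close>

lemma bipartite_chromatic_eq_clique:
  fixes P :: "'a \<Rightarrow> bool"
  assumes bip: "\<And>u v. {u, v} \<in> edges \<Gamma> \<Longrightarrow> u \<in> verts \<Gamma> \<Longrightarrow> v \<in> verts \<Gamma> \<Longrightarrow> P u \<noteq> P v"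
  shows "chromatic_number \<Gamma> = clique_number \<Gamma>"
proof (cases "\<exists>u\<in>verts \<Gamma>. \<exists>v\<in>verts \<Gamma>. {u, v} \<in> edges \<Gamma>")
  case True
  then obtain u v where uv: "u \<in> verts \<Gamma>" "v \<in> verts \<Gamma>" "{u, v} \<in> edges \<Gamma>" by blast
  with bip have "u \<noteq> v" by blast
  show ?thesis
  proof (rule chromatic_number_eq_clique_numberI)
    show "proper_colouring \<Gamma> 2 (\<lambda>w. if P w then 1 else 0)"
      using bip by (auto simp: proper_colouring_def)
    show "clique {u, v} (edges \<Gamma>)"
      using uv by (auto simp: clique_def insert_commute)
  qed (use uv \<open>u \<noteq> v\<close> in auto)
next
  case no_edge: False
  show ?thesis
  proof (cases "verts \<Gamma> = {}")
    case True
    show ?thesis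
      by (rule chromatic_number_eq_clique_numberI[where k = 0 and K = "{}" and c = "\<lambda>_. 0"])
        (use True in \<open>auto simp: proper_colouring_def\<close>)
  next
    case False
    then obtain u where "u \<in> verts \<Gamma>" by blast
    then show ?thesis
      by (intro chromatic_number_eq_clique_numberI[where k = 1 and K = "{u}" and c = "\<lambda>_. 0"])
        (use no_edge in \<open>auto simp: proper_colouring_def clique_def\<close>)
  qed
qed

lemma card_le_2I:
  assumes "finite K"
    and "\<And>a b c. a \<in> K \<Longrightarrow> b \<in> K \<Longrightarrow> c \<in> K \<Longrightarrow> a \<noteq> b \<Longrightarrow> a \<noteq> c \<Longrightarrow> b \<noteq> c \<Longrightarrow> False"
  shows "card K \<le> 2"
proof (rule ccontr)
  assume "\<not> card K \<le> 2"
  then obtain T where "T \<subseteq> K" "card T = 3"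
    using obtain_subset_with_card_n[of 3 K] by auto
  with assms(2) show False
    unfolding card_3_iff by blast
qed

text \<open>A pentagon has no triangle, so its clique number is at most 2, but an odd cycle cannot
  be coloured with two colours.\<close>

lemma induced_five_cycle_not_perfect:
  assumes V: "{a, b, c, d, e} \<subseteq> verts \<Gamma>"
    and E: "{a, b} \<in> edges \<Gamma>" "{b, c} \<in> edges \<Gamma>" "{c, d} \<in> edges \<Gamma>" "{d, e} \<in> edges \<Gamma>"
      "{e, a} \<in> edges \<Gamma>"
    and N: "{a, c} \<notin> edges \<Gamma>" "{b, d} \<notin> edges \<Gamma>" "{c, e} \<notin> edges \<Gamma>" "{d, a} \<notin> edges \<Gamma>"
      "{e, b} \<notin> edges \<Gamma>"
  shows "\<not> perfect_graph \<Gamma>"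
proof
  assume "perfect_graph \<Gamma>"
  define \<Delta> where "\<Delta> = induced_subgraph \<Gamma> {a, b, c, d, e}"
  have eq: "chromatic_number \<Delta> = clique_number \<Delta>"
    using \<open>perfect_graph \<Gamma>\<close> V unfolding perfect_graph_def \<Delta>_def by blast
  have "card K \<le> 2" if "finite K" "K \<subseteq> {a, b, c, d, e}" "clique K (edges \<Gamma>)" for K
  proof (rule card_le_2I[OF \<open>finite K\<close>])
    fix x y z
    assume "x \<in> K" "y \<in> K" "z \<in> K" and neq: "x \<noteq> y" "x \<noteq> z" "y \<noteq> z"
    then have "x \<in> {a, b, c, d, e}" "y \<in> {a, b, c, d, e}" "z \<in> {a, b, c, d, e}"
      and "{x, y} \<in> edges \<Gamma>" "{x, z} \<in> edges \<Gamma>" "{y, z} \<in> edges \<Gamma>"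
      using that by (auto simp: clique_def)
    \<comment> \<open>Among any three vertices of the pentagon two are not consecutive, hence form
      one of the pairs in \<open>N\<close>.\<close>
    then show False
      using N neq by (simp add: insert_commute) (elim disjE; simp add: insert_commute)
  qed
  then have "card K \<le> 2" if "finite K" "K \<subseteq> verts \<Delta>" "clique K (edges \<Delta>)" for K
    using that by (force simp: \<Delta>_def clique_def)
  then have "clique_number \<Delta> \<le> enat 2"
    unfolding clique_number_def by (intro Sup_least) auto
  \<comment> \<open>The strict form of the bound turns the infimum into an actual colouring with at
    most two colours.\<close>
  with eq have "chromatic_number \<Delta> < enat 3"
    by (metis enat_ord_simps(2) eval_nat_numeral(3) lessI order_le_less_trans)
  then obtain k f where "k < 3" and "proper_colouring \<Delta> k f"
    unfolding chromatic_number_def Inf_less_iff by auto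
  then have col: "f a < 2" "f b < 2" "f c < 2" "f d < 2" "f e < 2"
    "f a \<noteq> f b" "f b \<noteq> f c" "f c \<noteq> f d" "f d \<noteq> f e" "f e \<noteq> f a"
    using E by (auto simp: proper_colouring_def \<Delta>_def)
  show False
    using col by linarith
qed

section \<open>Difference graphs of finite groups\<close>

lemma (in group) subgroup_of_cyclic_is_cyclic:
  assumes fin: "finite (carrier G)" and z: "z \<in> carrier G"
    and H: "subgroup H G" "H \<subseteq> generate G {z}"
  shows "\<exists>y\<in>H. H = generate G {y}"
proof -
  \<comment> \<open>The least positive exponent landing in \<open>H\<close>; division with remainder
    by \<open>d\<close> shows that its power of \<open>z\<close> generates \<open>H\<close>. Such an
    exponent exists because \<open>ord z\<close> is positive in a finite group.\<close>
  define d where "d = (LEAST n::nat. 0 < n \<and> z [^] n \<in> H)"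
  have "0 < ord z \<and> z [^] ord z \<in> H"
    using z ord_ge_1[OF fin z] H(1) by (auto simp: subgroup.one_closed)
  then have d: "0 < d \<and> z [^] d \<in> H"
    unfolding d_def by (rule LeastI)
  have "h \<in> generate G {z [^] d}" if "h \<in> H" for h
  proof -
    obtain n :: nat where n: "h = z [^] n"
      using \<open>h \<in> H\<close> H(2) generate_pow_on_finite_carrier[OF fin z] by blast
    have split: "z [^] n = (z [^] d) [^] (n div d) \<otimes> z [^] (n mod d)"
      using z by (simp add: nat_pow_pow nat_pow_mult)
    have pw: "(z [^] d) [^] (n div d) \<in> H"
      using d H(1) by (metis int_pow_int subgroup_int_pow_closed)
    have "z [^] (n mod d) = inv ((z [^] d) [^] (n div d)) \<otimes> z [^] n"
      unfolding split using z by (simp add: m_assoc[symmetric])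
    then have "z [^] (n mod d) \<in> H"
      using pw \<open>h \<in> H\<close> n H(1) by (simp add: subgroup.m_closed subgroup.m_inv_closed)
    moreover have "n mod d < d"
      using d by simp
    ultimately have "n mod d = 0"
      using not_less_Least[of "n mod d" "\<lambda>n. 0 < n \<and> z [^] n \<in> H"] by (auto simp: d_def)
    then have "h = (z [^] d) [^] (n div d)"
      using split z n by simp
    then show ?thesis
      using generate_pow_on_finite_carrier[OF fin, of "z [^] d"] z by auto
  qed
  moreover have "generate G {z [^] d} \<subseteq> H"
    using d H(1) generate_subgroup_incl by simp
  ultimately show ?thesis
    using d by blast
qed

text \<open>Replaces cyclicity of the generated subgroup by a common cyclic overgroup, for which a
  generator can be exhibited. The converse holds because subgroups of cyclic groups are
  cyclic.\<close>

lemma (in group) cyclic_subgroup_generated_pair_iff: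
  assumes fin: "finite (carrier G)" and ab: "a \<in> carrier G" "b \<in> carrier G"
  shows "cyclic_group (subgroup_generated G {a, b}) \<longleftrightarrow>
    (\<exists>z\<in>carrier G. a \<in> generate G {z} \<and> b \<in> generate G {z})"
proof
  let ?S = "subgroup_generated G {a, b}"
  have S: "carrier ?S = generate G {a, b}"
    using ab by (simp add: carrier_subgroup_generated)
  assume "cyclic_group ?S"
  then obtain z where z: "z \<in> carrier ?S" "carrier ?S = range (\<lambda>n::int. z [^]\<^bsub>?S\<^esub> n)"
    using group.cyclic_group[OF group_subgroup_generated, of "{a, b}"] by blast
  have zG: "z \<in> carrier G"
    using z(1) carrier_subgroup_generated_subset by blast
  have "carrier ?S = generate G {z}"
    unfolding z(2) generate_pow[OF zG] int_pow_subgroup_generated[OF z(1)] by auto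
  moreover have "a \<in> carrier ?S" "b \<in> carrier ?S"
    unfolding S by (auto intro: generate.incl)
  ultimately show "\<exists>z\<in>carrier G. a \<in> generate G {z} \<and> b \<in> generate G {z}"
    using zG by blast
next
  assume "\<exists>z\<in>carrier G. a \<in> generate G {z} \<and> b \<in> generate G {z}"
  then obtain z where z: "z \<in> carrier G" "{a, b} \<subseteq> generate G {z}" by blast
  then have sub: "generate G {a, b} \<subseteq> generate G {z}"
    by (intro generate_subgroup_incl generate_is_subgroup) auto
  have "subgroup (generate G {a, b}) G"
    using ab by (intro generate_is_subgroup) auto
  from subgroup_of_cyclic_is_cyclic[OF fin z(1) this sub]
  obtain y where y: "y \<in> generate G {a, b}" "generate G {a, b} = generate G {y}"
    by (elim bexE)
  then have "y \<in> carrier G"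
    using generate_in_carrier[of "{a, b}"] ab by auto
  then have "subgroup_generated G {a, b} = subgroup_generated G {y}"
    using ab y(2) by (simp add: subgroup_generated_def)
  then show "cyclic_group (subgroup_generated G {a, b})"
    by (simp add: cyclic_group_generated)
qed

text \<open>Inside one finite cyclic group a subgroup is determined by its order. With
  \<open>a\<close> and \<open>b\<close> written as powers of \<open>z\<close> with exponents
  \<open>i\<close> and \<open>j\<close>, membership means solving \<open>j * t = i\<close> modulo
  \<open>ord z\<close>, which is possible once \<open>gcd j (ord z)\<close> divides
  \<open>i\<close>.\<close>

lemma (in group) mem_generate_iff_ord_dvd:
  assumes fin: "finite (carrier G)" and z: "z \<in> carrier G"
    and a: "a \<in> generate G {z}" and b: "b \<in> generate G {z}"
  shows "a \<in> generate G {b} \<longleftrightarrow> ord a dvd ord b"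
proof
  have bG: "b \<in> carrier G" and aG: "a \<in> carrier G"
    using a b z generate_in_carrier[of "{z}"] by auto
  assume "a \<in> generate G {b}"
  then obtain n :: nat where "a = b [^] n"
    using generate_pow_on_finite_carrier[OF fin bG] by blast
  then have "a [^] ord b = \<one>"
    using bG by (simp add: nat_pow_pow mult.commute[of n]) (simp flip: nat_pow_pow)
  then show "ord a dvd ord b"
    using aG by (simp add: pow_eq_id)
next
  have bG: "b \<in> carrier G"
    using b z generate_in_carrier[of "{z}"] by auto
  obtain i j :: nat where ij: "a = z [^] i" "b = z [^] j"
    using a b generate_pow_on_finite_carrier[OF fin z] by blast
  assume dvd: "ord a dvd ord b"
  let ?g = "gcd (ord z) j"
  have "z [^] (i * ord b) = \<one>"
    using dvd z unfolding ij by (simp flip: nat_pow_pow add: pow_eq_id)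
  then have "ord z dvd i * ord b"
    using z by (simp add: pow_eq_id)
  \<comment> \<open>Cancelling \<open>ord b\<close> from \<open>ord z dvd i * ord b\<close> will
    leave the solvability condition \<open>?g dvd i\<close>.\<close>
  moreover have "ord b * ?g = ord z"
    unfolding ij ord_pow_gen[OF z] by (auto simp: gcd_0_nat)
  moreover have "0 < ord z"
    using ord_ge_1[OF fin z] by simp
  ultimately have "?g * ord b dvd i * ord b \<and> 0 < ord b"
    by (metis mult.commute mult_0 neq0_conv)
  then have "gcd j (ord z) dvd i"
    by (auto simp: gcd.commute)
  then obtain t where "[j * t = i] (mod ord z)"
    using cong_solve_dvd_nat by blast
  then have "int (ord z) dvd int i - int (j * t)"
    by (metis cong_iff_dvd_diff cong_int_iff cong_sym)
  then have "z [^] int (j * t) = z [^] int i"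
    using z by (simp only: int_pow_eq)
  then have "a = b [^] t"
    using z unfolding ij by (simp add: nat_pow_pow int_pow_int del: of_nat_mult)
  then show "a \<in> generate G {b}"
    using generate_pow_on_finite_carrier[OF fin bG] by blast
qed

lemma doubleton_mem_Collect_iff: "{a, b} \<in> {{x, y} | x y. P x y} \<longleftrightarrow> P a b \<or> P b a"
  by (auto simp: doubleton_eq_iff)

text \<open>The carrier conditions and \<open>a \<noteq> b\<close> of the definitions are absorbed:
  a common generator \<open>z\<close> forces the former, and \<open>a \<in> generate G {a}\<close>
  excludes equality.\<close>

lemma (in group) edge_difference_graph_iff:
  assumes fin: "finite (carrier G)"
  shows "{a, b} \<in> edges (difference_graph G) \<longleftrightarrow>
    (\<exists>z\<in>carrier G. a \<in> generate G {z} \<and> b \<in> generate G {z}) \<and>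
       a \<notin> generate G {b} \<and> b \<notin> generate G {a}" (is "_ \<longleftrightarrow> ?cyc \<and> _")
proof -
  have swap: "{b, a} = {a, b}"
    by blast
  have "edges (difference_graph G) =
     {{a, b} | a b. a \<in> carrier G \<and> b \<in> carrier G \<and> a \<noteq> b \<and>
         cyclic_group (subgroup_generated G {a, b})} -
     {{a, b} | a b. a \<in> carrier G \<and> b \<in> carrier G \<and> a \<noteq> b \<and>
         (a \<in> generate G {b} \<or> b \<in> generate G {a})}"
    by (simp add: difference_graph_def remove_isolated_def graph_minus_def edges_def
        enhanced_power_graph_def power_graph_def)
  then have "{a, b} \<in> edges (difference_graph G) \<longleftrightarrow>
     a \<in> carrier G \<and> b \<in> carrier G \<and> a \<noteq> b \<and> cyclic_group (subgroup_generated G {a, b}) \<and>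
     a \<notin> generate G {b} \<and> b \<notin> generate G {a}"
    by (simp only: Diff_iff doubleton_mem_Collect_iff swap) blast
  also have "\<dots> \<longleftrightarrow> ?cyc \<and> a \<notin> generate G {b} \<and> b \<notin> generate G {a}"
  proof (cases "a \<in> carrier G \<and> b \<in> carrier G")
    case True
    moreover have "a \<in> generate G {a}"
      by (simp add: generate.incl)
    ultimately show ?thesis
      by (auto simp: cyclic_subgroup_generated_pair_iff[OF fin])
  next
    case False
    then show ?thesis
      using generate_in_carrier[of "{_}"] by auto
  qed
  finally show ?thesis .
qed

lemma (in group) edge_difference_graph_ord:
  assumes fin: "finite (carrier G)"
  shows "{a, b} \<in> edges (difference_graph G) \<longleftrightarrow>
    (\<exists>z\<in>carrier G. a \<in> generate G {z} \<and> b \<in> generate G {z}) \<and>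
       \<not> ord a dvd ord b \<and> \<not> ord b dvd ord a"
  unfolding edge_difference_graph_iff[OF fin] using mem_generate_iff_ord_dvd[OF fin] by blast

lemma verts_difference_graph:
  "v \<in> verts (difference_graph G) \<longleftrightarrow>
    v \<in> carrier G \<and> (\<exists>e\<in>edges (difference_graph G). v \<in> e)"
  by (auto simp: difference_graph_def remove_isolated_def graph_minus_def edges_def verts_def
      enhanced_power_graph_def)

section \<open>Groups whose order divides a prime times the square of a prime\<close>

text \<open>Divisors that agree on divisibility by \<open>t\<close> form a chain: after removing a
  common factor \<open>t\<close>, if there is one, both are powers of \<open>s\<close>.\<close>

lemma incomparable_dvd_prime_power2:
  fixes d e t s :: nat
  assumes "Factorial_Ring.prime t" "Factorial_Ring.prime s" "d dvd t * s ^ 2" "e dvd t * s ^ 2"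
    and inc: "\<not> d dvd e" "\<not> e dvd d"
  shows "(t dvd d) \<noteq> (t dvd e)"
proof
  have chain: "d dvd e \<or> e dvd d" if de: "d dvd s ^ 2" "e dvd s ^ 2" for d e
  proof -
    obtain i j where "d = s ^ i" "e = s ^ j"
      using de assms(2) by (auto simp: divides_primepow_nat)
    then show ?thesis
      by (metis le_imp_power_dvd nle_le)
  qed
  assume eq: "t dvd d \<longleftrightarrow> t dvd e"
  show False
  proof (cases "t dvd d")
    case True
    then obtain d' e' where "d = t * d'" "e = t * e'"
      using eq by (meson dvdE)
    then show False
      using assms chain[of d' e'] prime_gt_0_nat[OF assms(1)] by auto
  next
    case False
    then have "coprime d t" "coprime e t"
      using assms(1) eq by (auto simp: prime_imp_coprime coprime_commute[of _ t])
    then show False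
      using assms chain[of d e] by (auto simp: coprime_dvd_mult_right_iff)
  qed
qed

lemma (in group) perfect_difference_graph_prime_times_square:
  assumes fin: "finite (carrier G)" and ts: "Factorial_Ring.prime t" "Factorial_Ring.prime s"
    and dvd: "order G dvd t * s ^ 2"
  shows "perfect_graph (difference_graph G)"
  unfolding perfect_graph_def
proof (intro allI impI)
  fix W assume W: "W \<subseteq> verts (difference_graph G)"
  then have carr: "w \<in> carrier G" if "w \<in> W" for w
    using that by (auto simp: verts_difference_graph)
  show "chromatic_number (induced_subgraph (difference_graph G) W) =
      clique_number (induced_subgraph (difference_graph G) W)"
  proof (rule bipartite_chromatic_eq_clique[where P = "\<lambda>w. t dvd ord w"])
    fix u v assume "{u, v} \<in> edges (induced_subgraph (difference_graph G) W)"
    then have "u \<in> W" "v \<in> W" "\<not> ord u dvd ord v" "\<not> ord v dvd ord u"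
      by (auto simp: edge_difference_graph_ord[OF fin])
    then show "(t dvd ord u) \<noteq> (t dvd ord v)"
      using carr ord_dvd_group_order dvd
      by (intro incomparable_dvd_prime_power2[OF ts]) (meson dvd_trans)+
  qed
qed

section \<open>Cyclic groups whose order divides a product of three distinct primes\<close>

lemma dvd_prime_product_cases:
  fixes d q r :: nat
  assumes "Factorial_Ring.prime q" "Factorial_Ring.prime r" "d dvd q * r"
  shows "d = 1 \<or> d = q \<or> d = r \<or> d = q * r"
proof (cases "q dvd d")
  case True
  then obtain d' where d': "d = q * d'" by blast
  then have "d' dvd r"
    using assms by (auto dest: prime_gt_0_nat)
  then show ?thesis
    using assms(2) d' by (auto simp: prime_nat_iff)
next
  case False
  then have "coprime d q"
    using assms(1) by (simp add: prime_imp_coprime coprime_commute[of _ q])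
  then have "d dvd r"
    using assms(3) by (simp add: coprime_dvd_mult_right_iff)
  then show ?thesis
    using assms(2) by (auto simp: prime_nat_iff)
qed

lemma incomparable_dvd_prime_product:
  fixes d e q r :: nat
  assumes "Factorial_Ring.prime q" "Factorial_Ring.prime r" "d dvd q * r" "e dvd q * r"
    and "\<not> d dvd e" "\<not> e dvd d"
  shows "{d, e} = {q, r}"
  using dvd_prime_product_cases[OF assms(1-3)] dvd_prime_product_cases[OF assms(1,2,4)] assms(5,6)
  by auto

text \<open>For three primes, the incomparability graph of the divisors of \<open>l * m * n\<close> is a triangular
  prism; the divisors divisible by \<open>l\<close> contribute the edge \<open>lm\<close>--\<open>ln\<close>, the others the edge
  \<open>m\<close>--\<open>n\<close>, and every other edge separates the two kinds.\<close>

lemma incomparable_dvd_three_primes: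
  fixes d e l m n :: nat
  assumes primes: "Factorial_Ring.prime l" "Factorial_Ring.prime m" "Factorial_Ring.prime n"
    and d: "d dvd l * m * n" and e: "e dvd l * m * n"
    and inc: "\<not> d dvd e" "\<not> e dvd d"
    and eq: "l dvd d \<longleftrightarrow> l dvd e"
  shows "{d, e} = {m, n} \<or> {d, e} = {l * m, l * n}"
proof (cases "l dvd d")
  case True
  then obtain d' e' where de: "d = l * d'" "e = l * e'"
    using eq by (meson dvdE)
  then have "{d', e'} = {m, n}"
    using d e inc prime_gt_0_nat[OF primes(1)]
    by (intro incomparable_dvd_prime_product[OF primes(2,3)]) (auto simp: mult.assoc)
  then show ?thesis
    unfolding de by (auto simp: doubleton_eq_iff)
next
  case False
  then have "coprime d l" "coprime e l"
    using primes(1) eq by (auto simp: prime_imp_coprime coprime_commute[of _ l])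
  then have "{d, e} = {m, n}"
    using d e inc
    by (intro incomparable_dvd_prime_product[OF primes(2,3)])
      (auto simp: coprime_dvd_mult_right_iff mult.assoc)
  then show ?thesis ..
qed

lemma dvd_three_primes_cases:
  fixes d p q r :: nat
  assumes "Factorial_Ring.prime p" "Factorial_Ring.prime q" "Factorial_Ring.prime r"
    "d dvd p * q * r"
  shows "d \<in> {1, p, q, r, p * q, p * r, q * r, p * q * r}"
proof (cases "p dvd d")
  case True
  then obtain d' where d': "d = p * d'" by blast
  then have "d' dvd q * r"
    using assms by (auto simp: mult.assoc dest: prime_gt_0_nat)
  then show ?thesis
    using dvd_prime_product_cases[OF assms(2,3)] d' by (auto simp: mult.assoc)
next
  case False
  then have "coprime d p"
    using assms(1) by (simp add: prime_imp_coprime coprime_commute[of _ p])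
  then have "d dvd q * r"
    using assms(4) by (simp add: coprime_dvd_mult_right_iff mult.assoc)
  then show ?thesis
    using dvd_prime_product_cases[OF assms(2,3)] by auto
qed

text \<open>As \<open>z\<close> generates everything, adjacency is incomparability of orders. If
  \<open>W\<close> meets all three orders of a triangle of the prism, that triangle matches a fixed
  3-colouring; otherwise divisibility by a suitable prime is a bipartition.\<close>

lemma (in group) perfect_difference_graph_cyclic_three_primes:
  assumes fin: "finite (carrier G)"
    and z: "z \<in> carrier G" "carrier G = generate G {z}"
    and primes: "Factorial_Ring.prime p" "Factorial_Ring.prime q" "Factorial_Ring.prime r"
    and distinct: "p \<noteq> q" "p \<noteq> r" "q \<noteq> r"
    and dvd: "order G dvd p * q * r"
  shows "perfect_graph (difference_graph G)"
  unfolding perfect_graph_def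
proof (intro allI impI)
  fix W assume W: "W \<subseteq> verts (difference_graph G)"
  define \<Delta> where "\<Delta> = induced_subgraph (difference_graph G) W"
  have verts: "verts \<Delta> = W"
    by (simp add: \<Delta>_def)
  have carr: "w \<in> carrier G" if "w \<in> W" for w
    using W that by (auto simp: verts_difference_graph)
  have ord_dvd: "ord w dvd p * q * r" if "w \<in> W" for w
    using carr[OF that] ord_dvd_group_order dvd dvd_trans by blast
  have edge: "{u, v} \<in> edges \<Delta> \<longleftrightarrow>
      u \<in> W \<and> v \<in> W \<and> \<not> ord u dvd ord v \<and> \<not> ord v dvd ord u" for u v
    using carr z by (auto simp: \<Delta>_def edge_difference_graph_ord[OF fin])
  \<comment> \<open>\<open>missing\<close> says that neither of the two prism edges on which
    divisibility by \<open>l\<close> is constant occurs in \<open>W\<close>. The argument is stated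
    for any ordering of the three primes.\<close>
  have bipartite: "chromatic_number \<Delta> = clique_number \<Delta>"
    if lmn: "Factorial_Ring.prime l" "Factorial_Ring.prime m" "Factorial_Ring.prime n"
      "l * m * n = p * q * r"
      and missing: "m \<notin> ord ` W \<or> n \<notin> ord ` W" "l * m \<notin> ord ` W \<or> l * n \<notin> ord ` W"
    for l m n
  proof (rule bipartite_chromatic_eq_clique[where P = "\<lambda>w. l dvd ord w"])
    fix u v assume "{u, v} \<in> edges \<Delta>"
    then have uv: "u \<in> W" "v \<in> W" "\<not> ord u dvd ord v" "\<not> ord v dvd ord u"
      by (auto simp: edge)
    show "(l dvd ord u) \<noteq> (l dvd ord v)"
    proof
      assume "l dvd ord u \<longleftrightarrow> l dvd ord v"
      with uv have "{ord u, ord v} = {m, n} \<or> {ord u, ord v} = {l * m, l * n}"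
        using ord_dvd lmn by (intro incomparable_dvd_three_primes) auto
      moreover have "{ord u, ord v} \<subseteq> ord ` W"
        using uv by auto
      ultimately have "{m, n} \<subseteq> ord ` W \<or> {l * m, l * n} \<subseteq> ord ` W"
        by metis
      then show False
        using missing by blast
    qed
  qed
  \<comment> \<open>The colour classes split the eight divisors into the chains
    \<open>p, p * q\<close>, then \<open>q, q * r\<close>, then
    \<open>1, r, p * r, p * q * r\<close>; comparable orders give no edge.\<close>
  define c :: "nat \<Rightarrow> nat" where
    "c d = (if d \<in> {p, p * q} then 0 else if d \<in> {q, q * r} then 1 else 2)" for d
  have chain: "d dvd e \<or> e dvd d" if de: "d dvd p * q * r" "e dvd p * q * r" "c d = c e" for d e
  proof -
    have c2: "d \<in> {1, r, p * r, p * q * r}" if "d dvd p * q * r" "c d = 2" for d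
      using dvd_three_primes_cases[OF primes that(1)] that(2)
      unfolding c_def by (auto split: if_splits)
    consider "d \<in> {p, p * q}" "e \<in> {p, p * q}" | "d \<in> {q, q * r}" "e \<in> {q, q * r}"
      | "c d = 2" "c e = 2"
      using de(3) unfolding c_def by (simp split: if_splits)
    then show ?thesis
    proof cases
      case 3
      then have "d \<in> {1, r, p * r, p * q * r}" "e \<in> {1, r, p * r, p * q * r}"
        using c2 de by blast+
      then show ?thesis
        by (elim insertE emptyE) simp_all
    qed (elim insertE emptyE; simp)+
  qed
  have colouring: "proper_colouring \<Delta> 3 (c \<circ> ord)"
    unfolding proper_colouring_def
  proof (intro conjI ballI impI)
    show "(c \<circ> ord) ` verts \<Delta> \<subseteq> {..<3}"
      by (auto simp: c_def)
    fix u v assume "{u, v} \<in> edges \<Delta>"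
    then show "(c \<circ> ord) u \<noteq> (c \<circ> ord) v"
      using chain[OF ord_dvd ord_dvd] by (auto simp: edge)
  qed
  have triangle: "chromatic_number \<Delta> = clique_number \<Delta>"
    if ijk: "{i, j, k} \<subseteq> ord ` W" "\<not> i dvd j" "\<not> j dvd i" "\<not> i dvd k" "\<not> k dvd i"
      "\<not> j dvd k" "\<not> k dvd j" for i j k
  proof -
    obtain u v w where uvw: "u \<in> W" "v \<in> W" "w \<in> W" "ord u = i" "ord v = j" "ord w = k"
      using ijk(1) by auto
    then have "u \<noteq> v" "u \<noteq> w" "v \<noteq> w"
      using ijk by auto
    then show ?thesis
      by (intro chromatic_number_eq_clique_numberI[OF colouring, where K = "{u, v, w}"])
        (use uvw ijk in \<open>auto simp: verts clique_def edge\<close>)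
  qed
  have ndvd: "\<not> p dvd q" "\<not> q dvd p" "\<not> p dvd r" "\<not> r dvd p" "\<not> q dvd r" "\<not> r dvd q"
    using primes distinct by (auto dest: primes_dvd_imp_eq)
  have pos: "p > 0" "q > 0" "r > 0"
    using primes by (auto intro: prime_gt_0_nat)
  have ndvd2: "\<not> p * q dvd p * r" "\<not> p * r dvd p * q" "\<not> p * q dvd q * r" "\<not> q * r dvd p * q"
    "\<not> p * r dvd q * r" "\<not> q * r dvd p * r"
    using ndvd pos by (auto simp: mult.commute[of p q])
  \<comment> \<open>A triangle lacking a vertex lacks two of its three edges. Each prime
    \<open>l\<close> labels one edge of each triangle, \<open>m\<close>--\<open>n\<close> and
    \<open>l * m\<close>--\<open>l * n\<close>; two pairs of labels out of three meet, so some
    \<open>l\<close> has both its edges missing.\<close>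
  consider "{p, q, r} \<subseteq> ord ` W" | "{p * q, p * r, q * r} \<subseteq> ord ` W"
    | "q \<notin> ord ` W \<or> r \<notin> ord ` W" "p * q \<notin> ord ` W \<or> p * r \<notin> ord ` W"
    | "p \<notin> ord ` W \<or> r \<notin> ord ` W" "q * p \<notin> ord ` W \<or> q * r \<notin> ord ` W"
    | "p \<notin> ord ` W \<or> q \<notin> ord ` W" "r * p \<notin> ord ` W \<or> r * q \<notin> ord ` W"
    by (auto simp: mult.commute)
  then have "chromatic_number \<Delta> = clique_number \<Delta>"
  proof cases
    case 1 then show ?thesis using ndvd by (rule triangle)
  next
    case 2 then show ?thesis using ndvd2 by (rule triangle)
  next
    case 3 then show ?thesis using primes by (intro bipartite[of p q r]) auto
  next
    case 4 then show ?thesis using primes by (intro bipartite[of q p r]) (auto simp: mult_ac)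
  next
    case 5 then show ?thesis using primes by (intro bipartite[of r p q]) (auto simp: mult_ac)
  qed
  then show "chromatic_number (induced_subgraph (difference_graph G) W) =
      clique_number (induced_subgraph (difference_graph G) W)"
    by (simp add: \<Delta>_def)
qed

section \<open>Semidirect products\<close>

lemma AutoGroup_simps [simp]:
  "carrier (AutoGroup G) = auto G"
  "\<one>\<^bsub>AutoGroup G\<^esub> = (\<lambda>x\<in>carrier G. x)"
  by (simp_all add: AutoGroup_def BijGroup_def)

lemma mult_AutoGroup:
  "f \<in> auto G \<Longrightarrow> g \<in> auto G \<Longrightarrow> f \<otimes>\<^bsub>AutoGroup G\<^esub> g = compose (carrier G) f g"
  by (simp add: AutoGroup_def BijGroup_def auto_def)

context
  fixes N (structure) and K (structure) and \<phi>
  assumes N: "group N" and K: "group K" and \<phi>: "\<phi> \<in> hom K (AutoGroup N)"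
begin

interpretation N: group N by (rule N)
interpretation K: group K by (rule K)
interpretation \<phi>: group_hom K "AutoGroup N" \<phi>
  by (intro group_hom.intro group_hom_axioms.intro K N.AutoGroup \<phi>)

text \<open>As simp rules these would move products and inverses of \<open>K\<close> into
  \<open>AutoGroup N\<close>, away from the pointwise rules below.\<close>

declare \<phi>.hom_mult [simp del] \<phi>.hom_inv [simp del]

lemma action_hom: "k \<in> carrier K \<Longrightarrow> \<phi> k \<in> hom N N"
  using \<phi>.hom_closed by (simp add: auto_def)

lemma action_closed: "k \<in> carrier K \<Longrightarrow> n \<in> carrier N \<Longrightarrow> \<phi> k n \<in> carrier N"
  using action_hom hom_in_carrier by metis

lemma action_mult:
  assumes "k \<in> carrier K" "k' \<in> carrier K" "n \<in> carrier N"
  shows "\<phi> (k \<otimes>\<^bsub>K\<^esub> k') n = \<phi> k (\<phi> k' n)"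
  using assms \<phi>.hom_closed by (simp add: mult_AutoGroup compose_eq \<phi>.hom_mult)

lemma action_one: "n \<in> carrier N \<Longrightarrow> \<phi> \<one>\<^bsub>K\<^esub> n = n"
  using \<phi>.hom_one by simp

lemma action_fixes_one: "k \<in> carrier K \<Longrightarrow> \<phi> k \<one>\<^bsub>N\<^esub> = \<one>\<^bsub>N\<^esub>"
  using action_hom hom_one N by blast

lemma action_pow:
  "k \<in> carrier K \<Longrightarrow> \<phi> (k [^]\<^bsub>K\<^esub> (i::nat)) = \<phi> k [^]\<^bsub>AutoGroup N\<^esub> i"
  by (rule \<phi>.hom_nat_pow)

lemma group_semidirect_product: "group (semidirect_product N K \<phi>)"
proof (rule groupI)
  fix g h
  assume "g \<in> carrier (semidirect_product N K \<phi>)" "h \<in> carrier (semidirect_product N K \<phi>)"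
  then show "g \<otimes>\<^bsub>semidirect_product N K \<phi>\<^esub> h \<in> carrier (semidirect_product N K \<phi>)"
    by (auto simp: semidirect_product_def action_closed)
next
  show "\<one>\<^bsub>semidirect_product N K \<phi>\<^esub> \<in> carrier (semidirect_product N K \<phi>)"
    by (simp add: semidirect_product_def)
next
  fix g h j
  assume "g \<in> carrier (semidirect_product N K \<phi>)" "h \<in> carrier (semidirect_product N K \<phi>)"
    "j \<in> carrier (semidirect_product N K \<phi>)"
  then show "g \<otimes>\<^bsub>semidirect_product N K \<phi>\<^esub> h \<otimes>\<^bsub>semidirect_product N K \<phi>\<^esub> j =
      g \<otimes>\<^bsub>semidirect_product N K \<phi>\<^esub> (h \<otimes>\<^bsub>semidirect_product N K \<phi>\<^esub> j)"
    by (auto simp: semidirect_product_def action_closed action_mult N.m_assoc K.m_assoc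
        hom_mult[OF action_hom])
next
  fix g assume "g \<in> carrier (semidirect_product N K \<phi>)"
  then show "\<one>\<^bsub>semidirect_product N K \<phi>\<^esub> \<otimes>\<^bsub>semidirect_product N K \<phi>\<^esub> g = g"
    by (auto simp: semidirect_product_def action_one)
next
  fix g assume "g \<in> carrier (semidirect_product N K \<phi>)"
  then obtain n k where g: "g = (n, k)" "n \<in> carrier N" "k \<in> carrier K"
    by (auto simp: semidirect_product_def)
  \<comment> \<open>A left inverse suffices: with second component \<open>l = inv k\<close>, the
    equation \<open>m \<otimes> \<phi> l n = \<one>\<close> forces
    \<open>m = \<phi> l (inv n)\<close>.\<close>
  let ?h = "(\<phi> (inv\<^bsub>K\<^esub> k) (inv\<^bsub>N\<^esub> n), inv\<^bsub>K\<^esub> k)"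
  have "?h \<in> carrier (semidirect_product N K \<phi>)"
    using g by (simp add: semidirect_product_def action_closed)
  moreover have "\<phi> (inv\<^bsub>K\<^esub> k) (inv\<^bsub>N\<^esub> n) \<otimes>\<^bsub>N\<^esub> \<phi> (inv\<^bsub>K\<^esub> k) n = \<one>\<^bsub>N\<^esub>"
    using g by (simp add: action_fixes_one flip: hom_mult[OF action_hom])
  then have "?h \<otimes>\<^bsub>semidirect_product N K \<phi>\<^esub> g = \<one>\<^bsub>semidirect_product N K \<phi>\<^esub>"
    using g by (simp add: semidirect_product_def)
  ultimately show "\<exists>h\<in>carrier (semidirect_product N K \<phi>).
      h \<otimes>\<^bsub>semidirect_product N K \<phi>\<^esub> g = \<one>\<^bsub>semidirect_product N K \<phi>\<^esub>"
    by blast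
qed

end

section \<open>The group of order \<open>p q r\<^sup>2\<close>\<close>

lemma crt3_nat:
  fixes m1 m2 m3 :: nat
  assumes "coprime m1 m2" "coprime m1 m3" "coprime m2 m3"
  obtains k where "[k = a] (mod m1)" "[k = b] (mod m2)" "[k = c] (mod m3)"
proof -
  obtain k where k: "[k = a] (mod m1)" "[k = b] (mod m2)"
    using binary_chinese_remainder_nat[OF assms(1)] by blast
  have "coprime (m1 * m2) m3"
    using assms by simp
  then obtain j where j: "[j = k] (mod m1 * m2)" "[j = c] (mod m3)"
    using binary_chinese_remainder_nat by blast
  then have "[j = k] (mod m1)" "[j = k] (mod m2)"
    using cong_modulus_mult_nat by (blast, metis cong_modulus_mult_nat mult.commute)
  with k j show thesis
    using that cong_trans by blast
qed

text \<open>The cofactor of \<open>d\<close> has a prime factor, which must be \<open>p\<close>,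
  \<open>q\<close> or \<open>r\<close>; cancelling it leaves one of the three maximal proper
  divisors.\<close>

lemma proper_dvd_cases:
  fixes d p q r :: nat
  assumes "Factorial_Ring.prime p" "Factorial_Ring.prime q" "Factorial_Ring.prime r"
    and d: "d dvd p * q * r ^ 2" "d \<noteq> p * q * r ^ 2"
  shows "d dvd q * r ^ 2 \<or> d dvd p * r ^ 2 \<or> d dvd p * q * r"
proof -
  obtain e where e: "p * q * r ^ 2 = d * e"
    using d(1) by blast
  with d(2) have "e \<noteq> 1"
    by auto
  then obtain l where l: "Factorial_Ring.prime l" "l dvd e"
    using prime_factor_nat by blast
  then obtain f where f: "e = l * f"
    by blast
  have "l dvd p * q * r ^ 2"
    using e l(2) by simp
  then have "l dvd p \<or> l dvd q \<or> l dvd r"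
    using l(1) by (auto simp: prime_dvd_mult_iff dest: prime_dvd_power)
  then have "l = p \<or> l = q \<or> l = r"
    using l(1) assms(1-3) primes_dvd_imp_eq by blast
  moreover have "p > 0" "q > 0" "r > 0"
    using assms(1-3) prime_gt_0_nat by blast+
  ultimately show ?thesis
  proof (elim disjE)
    assume "l = p"
    then have "p * (q * r ^ 2) = p * (d * f)" using e f by (simp add: mult_ac)
    then show ?thesis using \<open>p > 0\<close> by simp
  next
    assume "l = q"
    then have "q * (p * r ^ 2) = q * (d * f)" using e f by (simp add: mult_ac)
    then show ?thesis using \<open>q > 0\<close> by simp
  next
    assume "l = r"
    then have "r * (p * q * r) = r * (d * f)" using e f by (simp add: mult_ac power2_eq_square)
    then show ?thesis using \<open>r > 0\<close> by simp
  qed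
qed

section \<open>Coordinates, powers and two cyclic subgroups\<close>

text \<open>Records the action through the standard generator \<open>1\<close> instead of
  \<open>x\<close> and \<open>\<psi>\<close>: multiples of \<open>r\<close> act trivially, and
  \<open>1\<close> does not.\<close>

locale order_r_action =
  fixes p q r :: nat and \<phi> :: "int \<Rightarrow> int \<Rightarrow> int"
  assumes primes: "Factorial_Ring.prime p" "Factorial_Ring.prime q" "Factorial_Ring.prime r"
    and distinct: "p \<noteq> q" "p \<noteq> r" "q \<noteq> r"
    and hom: "\<phi> \<in> hom (integer_mod_group (r ^ 2)) (AutoGroup (integer_mod_group q))"
    and kernel: "c \<in> carrier (integer_mod_group (r ^ 2)) \<Longrightarrow> int r dvd c \<Longrightarrow>
      b \<in> carrier (integer_mod_group q) \<Longrightarrow> \<phi> c b = b"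
    and nontrivial: "\<phi> 1 1 \<noteq> 1"
begin

definition group_G :: "(int \<times> int \<times> int) monoid" where
  "group_G = integer_mod_group p \<times>\<times>
     semidirect_product (integer_mod_group q) (integer_mod_group (r ^ 2)) \<phi>"

lemma gt_1: "1 < p" "1 < q" "1 < r"
  using primes prime_gt_1_nat by blast+

lemma square_gt: "1 < int r ^ 2" "int r < int r ^ 2"
  using gt_1 by (simp_all add: power2_eq_square less_1_mult)

lemma carrier_group_G: "carrier group_G = {0..<int p} \<times> {0..<int q} \<times> {0..<int (r ^ 2)}"
  using gt_1 by (simp add: group_G_def semidirect_product_def carrier_integer_mod_group)

lemma order_group_G: "order group_G = p * q * r ^ 2"
  by (simp add: order_def carrier_group_G card_cartesian_product nat_power_eq)

lemma one_group_G: "\<one>\<^bsub>group_G\<^esub> = (0, 0, 0)"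
  by (simp add: group_G_def semidirect_product_def)

lemma mult_group_G: "(a, b, c) \<otimes>\<^bsub>group_G\<^esub> (a', b', c') =
    ((a + a') mod int p, (b + \<phi> c b') mod int q, (c + c') mod int (r ^ 2))"
  by (simp add: group_G_def semidirect_product_def)

sublocale G: group group_G
  unfolding group_G_def
  by (intro DirProd_group group_semidirect_product hom) simp_all

lemma finite_group_G: "finite (carrier group_G)"
  by (simp add: carrier_group_G)

text \<open>The last coordinate is a homomorphic projection, so its powers are computed for every
  element, whatever the twist does to the middle one.\<close>

lemma snd_snd_pow: "g \<in> carrier group_G \<Longrightarrow>
    snd (snd (g [^]\<^bsub>group_G\<^esub> (k::nat))) = (int k * snd (snd g)) mod int (r ^ 2)"
proof (induction k)
  case 0
  then show ?case by (simp add: one_group_G)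
next
  case (Suc k)
  obtain a b c where g: "g = (a, b, c)" by (cases g)
  obtain a' b' c' where gk: "g [^]\<^bsub>group_G\<^esub> k = (a', b', c')"
    by (cases "g [^]\<^bsub>group_G\<^esub> k")
  show ?case
    using Suc by (simp add: g gk[unfolded g] mult_group_G mod_simps algebra_simps)
qed

text \<open>Under \<open>triv\<close> the twist never shows: all multiples of \<open>c\<close> act
  trivially, or the middle coordinate is the fixed element \<open>0\<close>. Powers are then
  coordinatewise.\<close>

lemma pow_group_G:
  assumes g: "(a, b, c) \<in> carrier group_G" and triv: "b = 0 \<or> int r dvd c"
  shows "(a, b, c) [^]\<^bsub>group_G\<^esub> (k::nat) =
    ((int k * a) mod int p, (int k * b) mod int q, (int k * c) mod int (r ^ 2))"
proof (induction k)
  case 0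
  then show ?case by (simp add: one_group_G)
next
  case (Suc k)
  have "(int k * c) mod int (r ^ 2) \<in> carrier (integer_mod_group (r ^ 2))"
    using gt_1 by (simp add: carrier_integer_mod_group)
  moreover have b: "b \<in> carrier (integer_mod_group q)"
    using g gt_1 by (simp add: carrier_group_G carrier_integer_mod_group)
  moreover have "int r dvd (int k * c) mod int (r ^ 2)" if "int r dvd c"
    using that by (simp add: dvd_mod power2_eq_square)
  ultimately have "\<phi> ((int k * c) mod int (r ^ 2)) b = b"
    using triv kernel action_fixes_one[OF _ _ hom] by auto
  then show ?case
    by (simp add: Suc mult_group_G mod_simps algebra_simps)
qed

lemma generate_group_G:
  assumes "(a, b, c) \<in> carrier group_G" "b = 0 \<or> int r dvd c"
  shows "generate group_G {(a, b, c)} =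
    range (\<lambda>k::nat. ((int k * a) mod int p, (int k * b) mod int q, (int k * c) mod int (r ^ 2)))"
  using assms by (auto simp: G.generate_pow_on_finite_carrier[OF finite_group_G] pow_group_G)

lemma coprimes: "coprime p q" "coprime p r" "coprime q r" "coprime p (r ^ 2)"
  using primes distinct by (simp_all add: primes_coprime)

lemma in_carrier: "(1, 1, int r) \<in> carrier group_G" "(1, 0, 1) \<in> carrier group_G"
  using gt_1 square_gt by (auto simp: carrier_group_G)

text \<open>The elements with \<open>int r dvd c\<close> form a direct product of cyclic groups of
  the coprime orders \<open>p\<close>, \<open>q\<close>, \<open>r\<close>. The Chinese remainder
  theorem gives the exponent, where \<open>c = int r * d\<close> is matched through \<open>d\<close>
  modulo \<open>r\<close>.\<close>

lemma mem_generate_pqr: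
  assumes g: "(a, b, c) \<in> carrier group_G" and c: "int r dvd c"
  shows "(a, b, c) \<in> generate group_G {(1, 1, int r)}"
proof -
  obtain d where d: "c = int r * d"
    using c by blast
  have ge: "0 \<le> a" "a < int p" "0 \<le> b" "b < int q" "0 \<le> c" "c < int (r ^ 2)"
    using g by (auto simp: carrier_group_G)
  then have "0 \<le> d" "d < int r"
    using gt_1 by (simp_all add: d zero_le_mult_iff power2_eq_square)
  obtain k where k: "[k = nat a] (mod p)" "[k = nat b] (mod q)" "[k = nat d] (mod r)"
    using crt3_nat[OF coprimes(1-3)] by blast
  have "int k mod int p = a" "int k mod int q = b"
    using k ge by (simp_all flip: cong_int_iff add: cong_def)
  moreover have "int k mod int r = d"
    using k(3) \<open>0 \<le> d\<close> \<open>d < int r\<close> by (simp flip: cong_int_iff add: cong_def)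
  then have "int k * int r mod int (r ^ 2) = c"
    using mult_mod_left[of "int k" "int r" "int r"] by (simp add: d power2_eq_square mult.commute)
  ultimately show ?thesis
    by (subst generate_group_G) (auto simp: in_carrier intro!: image_eqI[of _ _ k])
qed

text \<open>The second large cyclic subgroup, of order \<open>p * r ^ 2\<close>; together with the
  previous one it contains both ends of every edge of the pentagon.\<close>

lemma mem_generate_prr:
  assumes g: "(a, 0, c) \<in> carrier group_G"
  shows "(a, 0, c) \<in> generate group_G {(1, 0, 1)}"
proof -
  have ge: "0 \<le> a" "a < int p" "0 \<le> c" "c < int (r ^ 2)"
    using g by (auto simp: carrier_group_G)
  obtain k where k: "[k = nat a] (mod p)" "[k = nat c] (mod r ^ 2)"
    using binary_chinese_remainder_nat[OF coprimes(4)] by blast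
  have "int k mod int p = a" "int k mod int (r ^ 2) = c"
    using k ge by (simp_all flip: cong_int_iff add: cong_def)
  then show ?thesis
    by (subst generate_group_G) (auto simp: in_carrier intro!: image_eqI[of _ _ k])
qed

section \<open>The induced pentagon\<close>

lemma not_perfect: "\<not> perfect_graph (difference_graph group_G)"
proof -
  let ?D = "difference_graph group_G"
  let ?g1 = "(0, 0, 1) :: int \<times> int \<times> int" and ?g2 = "(1, 0, int r) :: int \<times> int \<times> int"
    and ?g3 = "(1, 1, 0) :: int \<times> int \<times> int" and ?g4 = "(0, 0, int r) :: int \<times> int \<times> int"
    and ?g5 = "(1, 0, 0) :: int \<times> int \<times> int"
  have carr: "?g1 \<in> carrier group_G" "?g2 \<in> carrier group_G" "?g3 \<in> carrier group_G"
    "?g4 \<in> carrier group_G" "?g5 \<in> carrier group_G"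
    using gt_1 square_gt by (auto simp: carrier_group_G)
  have r_dvd: "int r dvd int k * int r mod int (r ^ 2)" for k
    by (simp add: dvd_mod power2_eq_square)
  note iff = G.edge_difference_graph_iff[OF finite_group_G]
  \<comment> \<open>Each edge lies in one of the two cyclic subgroups above; what remains is that
    neither end is a power of the other, read off from coordinates.\<close>
  have edgeI: "{a, b} \<in> edges ?D"
    if "z \<in> {(1, 1, int r), (1, 0, 1)}" "a \<in> generate group_G {z}" "b \<in> generate group_G {z}"
      "a \<notin> generate group_G {b}" "b \<notin> generate group_G {a}" for a b z
    using that in_carrier unfolding iff by blast
  have E: "{?g1, ?g2} \<in> edges ?D" "{?g2, ?g3} \<in> edges ?D" "{?g3, ?g4} \<in> edges ?D"
    "{?g4, ?g5} \<in> edges ?D" "{?g5, ?g1} \<in> edges ?D"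
  proof -
    have "?g1 \<notin> generate group_G {?g2}"
    proof
      assume "?g1 \<in> generate group_G {?g2}"
      then have "\<exists>k. 1 = int k * int r mod int (r ^ 2)"
        using carr by (auto simp: generate_group_G)
      then have "int r dvd 1"
        using r_dvd by metis
      then show False
        using gt_1 by simp
    qed
    moreover have "?g2 \<notin> generate group_G {?g1}"
      using carr by (auto simp: generate_group_G)
    ultimately show "{?g1, ?g2} \<in> edges ?D"
      using carr by (intro edgeI[of "(1, 0, 1)"] mem_generate_prr) auto
    show "{?g2, ?g3} \<in> edges ?D"
      using carr gt_1 by (intro edgeI[of "(1, 1, int r)"] mem_generate_pqr) (auto simp: generate_group_G)
    show "{?g3, ?g4} \<in> edges ?D"
      using carr gt_1 by (intro edgeI[of "(1, 1, int r)"] mem_generate_pqr) (auto simp: generate_group_G)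
    show "{?g4, ?g5} \<in> edges ?D"
      using carr gt_1 by (intro edgeI[of "(1, 0, 1)"] mem_generate_prr) (auto simp: generate_group_G)
    show "{?g5, ?g1} \<in> edges ?D"
      using carr by (intro edgeI[of "(1, 0, 1)"] mem_generate_prr) (auto simp: generate_group_G)
  qed
  \<comment> \<open>Adjacent elements are powers of a common \<open>z\<close>. This excludes the
    pair \<open>?g1\<close>, \<open>?g3\<close>; in the other four non-edges one element is a power
    of the other.\<close>
  have commute: "a \<otimes>\<^bsub>group_G\<^esub> b = b \<otimes>\<^bsub>group_G\<^esub> a" if ab: "{a, b} \<in> edges ?D" for a b
  proof -
    obtain z where z: "z \<in> carrier group_G" "a \<in> generate group_G {z}" "b \<in> generate group_G {z}"
      using ab unfolding iff by blast
    then obtain i j :: nat where "a = z [^]\<^bsub>group_G\<^esub> i" "b = z [^]\<^bsub>group_G\<^esub> j"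
      using G.generate_pow_on_finite_carrier[OF finite_group_G] by auto
    then show ?thesis
      using z(1) by (simp add: G.nat_pow_mult add.commute)
  qed
  have N: "{?g1, ?g3} \<notin> edges ?D" "{?g2, ?g4} \<notin> edges ?D" "{?g3, ?g5} \<notin> edges ?D"
    "{?g4, ?g1} \<notin> edges ?D" "{?g5, ?g2} \<notin> edges ?D"
  proof -
    have one: "1 \<in> carrier (integer_mod_group (r ^ 2))" "1 \<in> carrier (integer_mod_group q)"
      using gt_1 by (auto simp: carrier_integer_mod_group)
    then have "\<phi> 1 1 \<in> carrier (integer_mod_group q)"
      by (intro action_closed[OF _ _ hom]) auto
    then have "\<phi> 1 1 mod int q \<noteq> 1"
      using nontrivial gt_1 by (simp add: carrier_integer_mod_group)
    \<comment> \<open>The middle coordinates of the two products are \<open>\<phi> 1 1\<close> and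
      \<open>1\<close>.\<close>
    then have "?g1 \<otimes>\<^bsub>group_G\<^esub> ?g3 \<noteq> ?g3 \<otimes>\<^bsub>group_G\<^esub> ?g1"
      using gt_1 action_fixes_one[OF _ _ hom] one(1)
        kernel[OF integer_mod_group_0, of 0] by (simp add: mult_group_G)
    then show "{?g1, ?g3} \<notin> edges ?D"
      using commute by blast
    have memI: "h \<in> generate group_G {(a, b, c)}"
      if "(a, b, c) \<in> carrier group_G" "b = 0 \<or> int r dvd c"
        "h = ((int k * a) mod int p, (int k * b) mod int q, (int k * c) mod int (r ^ 2))" for k a b c h
      using that by (auto simp: generate_group_G)
    \<comment> \<open>This power of \<open>?g2\<close> kills the first coordinate and keeps the
      last. The exponents \<open>l\<close> and \<open>m\<close> below likewise keep the first
      coordinate and kill another.\<close>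
    obtain k where k: "[k = 0] (mod p)" "[k = 1] (mod r ^ 2)"
      using binary_chinese_remainder_nat[OF coprimes(4)] by blast
    then have "int k mod int p = 0" "int k mod int (r ^ 2) = 1"
      using gt_1 square_gt by (simp_all flip: cong_int_iff add: cong_def)
    then have "?g4 \<in> generate group_G {?g2}"
      using carr square_gt mod_mult_left_eq[of "int k" "int (r ^ 2)" "int r"]
      by (intro memI[where k = k]) auto
    then show "{?g2, ?g4} \<notin> edges ?D"
      unfolding iff by blast
    obtain l where l: "[l = 1] (mod p)" "[l = 0] (mod q)"
      using binary_chinese_remainder_nat[OF coprimes(1)] by blast
    then have "int l mod int p = 1" "int l mod int q = 0"
      using gt_1 by (simp_all flip: cong_int_iff add: cong_def)
    then have "?g5 \<in> generate group_G {?g3}"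
      using carr by (intro memI[where k = l]) auto
    then show "{?g3, ?g5} \<notin> edges ?D"
      unfolding iff by blast
    have "?g4 \<in> generate group_G {?g1}"
      using carr square_gt by (intro memI[where k = r]) auto
    then show "{?g4, ?g1} \<notin> edges ?D"
      unfolding iff by blast
    obtain m where m: "[m = 1] (mod p)" "[m = 0] (mod r ^ 2)"
      using binary_chinese_remainder_nat[OF coprimes(4)] by blast
    then have "int m mod int p = 1" "int m mod int (r ^ 2) = 0"
      using gt_1 by (simp_all flip: cong_int_iff add: cong_def)
    then have "?g5 \<in> generate group_G {?g2}"
      using carr by (intro memI[where k = m]) auto
    then show "{?g5, ?g2} \<notin> edges ?D"
      unfolding iff by blast
  qed
  have "a \<in> verts ?D" if ab: "{a, b} \<in> edges ?D" for a b
  proof -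
    obtain z where "z \<in> carrier group_G" "a \<in> generate group_G {z}"
      using ab unfolding iff by blast
    then have "a \<in> carrier group_G"
      using G.generate_in_carrier[of "{z}" a] by simp
    then show ?thesis
      using ab unfolding verts_difference_graph by blast
  qed
  then have "{?g1, ?g2, ?g3, ?g4, ?g5} \<subseteq> verts ?D"
    using E by blast
  then show ?thesis
    using E N by (rule induced_five_cycle_not_perfect)
qed

section \<open>Proper subgroups\<close>

lemma perfect_proper_subgroup:
  assumes H: "subgroup H group_G" "H \<noteq> carrier group_G"
  shows "perfect_graph (difference_graph (group_G\<lparr>carrier := H\<rparr>))"
proof -
  let ?H = "group_G\<lparr>carrier := H\<rparr>"
  interpret H: group ?H
    using H(1) by (rule G.subgroup_imp_group)
  have sub: "H \<subseteq> carrier group_G"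
    using H(1) by (rule subgroup.subset)
  then have fin: "finite (carrier ?H)"
    using finite_group_G finite_subset by auto
  have ord_H: "order ?H = card H"
    by (simp add: order_def)
  have "card H dvd p * q * r ^ 2"
    using G.lagrange[OF H(1)] by (metis dvd_triv_right order_group_G)
  moreover have "card H \<noteq> p * q * r ^ 2"
    using H(2) sub card_subset_eq[OF finite_group_G sub] by (auto simp: order_def simp flip: order_group_G)
  ultimately consider "card H dvd q * r ^ 2" | "card H dvd p * r ^ 2" | "card H dvd p * q * r"
    using proper_dvd_cases[OF primes] by blast
  then show ?thesis
  proof cases
    case 1
    then show ?thesis
      using fin primes ord_H by (intro H.perfect_difference_graph_prime_times_square[of q r]) auto
  next
    case 2
    then show ?thesis
      using fin primes ord_H by (intro H.perfect_difference_graph_prime_times_square[of p r]) auto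
  next
    case 3
    \<comment> \<open>Every element of \<open>H\<close> is killed by \<open>p * q * r\<close>. In
      the last coordinate this says that \<open>r ^ 2\<close> divides \<open>p * q * r * c\<close>,
      hence \<open>r\<close> divides \<open>c\<close>, since \<open>r\<close> is coprime to
      \<open>p * q\<close>.\<close>
    have "H \<subseteq> generate group_G {(1, 1, int r)}"
    proof
      fix g assume g: "g \<in> H"
      obtain a b c where abc: "g = (a, b, c)" by (cases g)
      have "g [^]\<^bsub>?H\<^esub> (p * q * r) = \<one>\<^bsub>?H\<^esub>"
        using H.ord_dvd_group_order[of g] g 3 ord_H by (subst H.pow_eq_id) auto
      then have "g [^]\<^bsub>group_G\<^esub> (p * q * r) = (0, 0, 0)"
        using G.nat_pow_consistent[of g "p * q * r" H] by (simp add: one_group_G)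
      then have "int (p * q * r) * c mod int (r ^ 2) = 0"
        using snd_snd_pow[of g "p * q * r"] sub g by (auto simp: abc)
      then have "int r * int r dvd int r * (int p * int q * c)"
        by (simp add: mod_eq_0_iff_dvd power2_eq_square mult_ac)
      then have "int r dvd int p * int q * c"
        using gt_1 by simp
      moreover have "coprime (int r) (int p * int q)"
        using coprimes by (simp add: coprime_commute)
      ultimately have "int r dvd c"
        by (simp add: coprime_dvd_mult_right_iff)
      then show "g \<in> generate group_G {(1, 1, int r)}"
        using mem_generate_pqr sub g unfolding abc by blast
    qed
    from G.subgroup_of_cyclic_is_cyclic[OF finite_group_G in_carrier(1) H(1) this]
    obtain y where y: "y \<in> H" "H = generate group_G {y}"
      by (elim bexE)
    \<comment> \<open>Generation has to be transferred from \<open>group_G\<close> to the structure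
      \<open>?H\<close> whose graph is considered.\<close>
    then have "carrier ?H = generate ?H {y}"
      using G.generate_consistent[OF _ H(1), of "{y}"] by simp
    then show ?thesis
      using y(1) fin primes distinct 3 ord_H
      by (intro H.perfect_difference_graph_cyclic_three_primes[of y p q r]) auto
  qed
qed

lemma minimal_imperfect: "minimal_imperfect_group group_G"
  unfolding minimal_imperfect_group_def
  using G.is_group not_perfect perfect_proper_subgroup by blast

end

section \<open>From the generator \<open>x\<close> and its image \<open>\<psi>\<close> to the
  standard generator\<close>

theorem theorem7p8:
  fixes p q r :: nat
    and x :: int
    and \<psi> :: "int \<Rightarrow> int"
    and \<phi> :: "int \<Rightarrow> int \<Rightarrow> int"
  assumes "Factorial_Ring.prime p" and "Factorial_Ring.prime q" and "Factorial_Ring.prime r"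
    and "p \<noteq> q" and "p \<noteq> r" and "q \<noteq> r"
    and "r dvd q - 1"
    and "x \<in> carrier (integer_mod_group (r ^ 2))"
    and "generate (integer_mod_group (r ^ 2)) {x} = carrier (integer_mod_group (r ^ 2))"
    and "\<psi> \<in> carrier (AutoGroup (integer_mod_group q))"
    and "group.ord (AutoGroup (integer_mod_group q)) \<psi> = r"
    and "\<phi> \<in> hom (integer_mod_group (r ^ 2)) (AutoGroup (integer_mod_group q))"
    and "\<phi> x = \<psi>"
  shows "minimal_imperfect_group
    (integer_mod_group p \<times>\<times>
      semidirect_product (integer_mod_group q) (integer_mod_group (r ^ 2)) \<phi>)"
proof -
  let ?N = "integer_mod_group q" and ?K = "integer_mod_group (r ^ 2)"
  interpret K: group ?K
    by simp
  interpret A: group "AutoGroup ?N"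
    by (simp add: group.AutoGroup)
  note pow = action_pow[OF _ _ assms(12), simplified]
  have gt_1: "1 < q" "1 < r"
    using assms(2,3) prime_gt_1_nat by blast+
  then have "1 < int r ^ 2"
    by (simp add: less_1_mult power2_eq_square)
  have finK: "finite (carrier ?K)"
    using gt_1 by (simp add: carrier_integer_mod_group)
  have one: "1 \<in> carrier ?K"
    using \<open>1 < int r ^ 2\<close> by (simp add: carrier_integer_mod_group)
  have \<phi>_mem: "\<phi> 1 \<in> carrier (AutoGroup ?N)"
    using assms(12) one by (rule hom_in_carrier)
  have multiple: "\<phi> (int k mod int (r ^ 2)) = \<phi> 1 [^]\<^bsub>AutoGroup ?N\<^esub> k" for k :: nat
    using pow[OF one, of k] by simp
  have one_eq: "\<one>\<^bsub>AutoGroup ?N\<^esub> = (\<lambda>b\<in>carrier ?N. b)"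
    by simp
  \<comment> \<open>Since \<open>1\<close> is a multiple of \<open>x\<close>, the automorphism
    \<open>\<phi> 1\<close> is a power of \<open>\<psi>\<close>, so its order divides
    \<open>r\<close>.\<close>
  have "\<phi> 1 [^]\<^bsub>AutoGroup ?N\<^esub> r = \<one>\<^bsub>AutoGroup ?N\<^esub>"
  proof -
    obtain j :: nat where j: "1 = x [^]\<^bsub>?K\<^esub> j"
      using one unfolding assms(9)[symmetric] K.generate_pow_on_finite_carrier[OF finK assms(8)]
      by blast
    have "\<phi> 1 = \<psi> [^]\<^bsub>AutoGroup ?N\<^esub> j"
      unfolding j using action_pow[OF _ _ assms(12) assms(8)] assms(13) by simp
    then have "\<phi> 1 [^]\<^bsub>AutoGroup ?N\<^esub> r = (\<psi> [^]\<^bsub>AutoGroup ?N\<^esub> r) [^]\<^bsub>AutoGroup ?N\<^esub> j"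
      using assms(10) by (simp only: A.nat_pow_pow mult.commute)
    also have "\<psi> [^]\<^bsub>AutoGroup ?N\<^esub> r = \<one>\<^bsub>AutoGroup ?N\<^esub>"
      using A.pow_ord_eq_1[OF assms(10)] assms(11) by (simp only:)
    finally show ?thesis
      by (simp only: A.nat_pow_one)
  qed
  then have kernel: "\<phi> c = \<one>\<^bsub>AutoGroup ?N\<^esub>" if c: "c \<in> carrier ?K" "int r dvd c" for c
  proof -
    have c_range: "0 \<le> c" "c < int (r ^ 2)"
      using c(1) gt_1 by (auto simp: carrier_integer_mod_group)
    then obtain k where k: "c = int (r * k)"
      using c(2) by (metis dvdE int_dvd_int_iff zero_le_imp_eq_int)
    then have "\<phi> c = \<phi> 1 [^]\<^bsub>AutoGroup ?N\<^esub> (r * k)"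
      using multiple[of "r * k"] c_range by simp
    also have "\<dots> = (\<phi> 1 [^]\<^bsub>AutoGroup ?N\<^esub> r) [^]\<^bsub>AutoGroup ?N\<^esub> k"
      using A.nat_pow_pow[OF \<phi>_mem] by (simp only:)
    finally show ?thesis
      using \<open>\<phi> 1 [^]\<^bsub>AutoGroup ?N\<^esub> r = _\<close> by (simp only: A.nat_pow_one)
  qed
  \<comment> \<open>An automorphism fixing the generator \<open>1\<close> of \<open>?N\<close> is
    the identity. Then \<open>\<phi> x = \<psi>\<close> would be trivial too, against its order
    \<open>r > 1\<close>.\<close>
  have "\<phi> 1 1 \<noteq> 1"
  proof
    assume fix1: "\<phi> 1 1 = 1"
    have oneN: "1 \<in> carrier ?N"
      using gt_1 by (simp add: carrier_integer_mod_group)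
    have \<phi>_hom: "\<phi> 1 \<in> hom ?N ?N"
      using \<phi>_mem by (simp add: auto_def)
    have "\<phi> 1 b = b" if b: "b \<in> carrier ?N" for b
    proof -
      have b_range: "0 \<le> b" "b < int q"
        using b gt_1 by (auto simp: carrier_integer_mod_group)
      then have "b = 1 [^]\<^bsub>?N\<^esub> nat b"
        by simp
      moreover have "\<phi> 1 (1 [^]\<^bsub>?N\<^esub> nat b) = \<phi> 1 1 [^]\<^bsub>?N\<^esub> nat b"
        using group_hom.hom_nat_pow[of ?N ?N "\<phi> 1" 1 "nat b"] \<phi>_hom oneN
        by (simp add: group_hom_def group_hom_axioms_def)
      ultimately show ?thesis
        using fix1 by simp
    qed
    \<comment> \<open>Needed because the identity of \<open>AutoGroup ?N\<close> is a restricted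
      function; agreement on the carrier alone would not give equality.\<close>
    moreover have "\<phi> 1 \<in> extensional (carrier ?N)"
      using \<phi>_mem by (simp add: auto_def Bij_def)
    ultimately have "\<phi> 1 = \<one>\<^bsub>AutoGroup ?N\<^esub>"
      unfolding one_eq by (intro extensionalityI[of _ "carrier ?N"]) auto
    then have "\<phi> (int (nat x) mod int (r ^ 2)) = \<one>\<^bsub>AutoGroup ?N\<^esub>"
      unfolding multiple by (simp only: A.nat_pow_one)
    moreover have "int (nat x) mod int (r ^ 2) = x"
      using assms(8) gt_1 by (simp add: carrier_integer_mod_group)
    ultimately have "\<psi> = \<one>\<^bsub>AutoGroup ?N\<^esub>"
      using assms(13) by (simp only:)
    then have "r = 1"
      using A.ord_id assms(11) by (simp only:)
    then show False
      using gt_1 by simp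
  qed
  then interpret order_r_action p q r \<phi>
    using assms(1-6,12) kernel one_eq by unfold_locales (simp_all only: restrict_apply' not_False_eq_True)
  show ?thesis
    using minimal_imperfect by (simp only: group_G_def)
qed

end
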